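(* For every $\epsilon > 0$ there exist a doubling measure $\mu$ on $[0,1]^2$ that has a doubling constant less than $1+\epsilon$, and a continuous function $f \colon [0,1] \to [0,1]$, such that $$\mu(\operatorname{graph}(f)) > (1-\epsilon)\,\mu([0,1]^2),$$ where $\operatorname{graph}(f) = \{(x,f(x)) : x \in [0,1]\}$.
   Context: A square is a set of the form $[x,x+s]\times[y,y+s]$ with $x,y \in \mathbb{R}$ and sidelength $s>0$ (sides parallel to the coordinate axes, no rotation). Two squares are called adjacent if they intersect. A Borel regular measure $\mu$ on $[0,1]^2$ is called doubling if there exists a constant $C<\infty$ such that $$0 < \mu(Q_1) \le C\,\mu(Q_2) < \infty$$ for every pair of adjacent squares $Q_1, Q_2 \subset [0,1]^2$ with the same sidelength. Any constant $C$ for which this holds is called a doubling constant of $\mu$. *)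

theory Defs
  imports "HOL-Analysis.Analysis"
begin

definition unit_square :: "(real \<times> real) set" where
  "unit_square = {0..1} \<times> {0..1}"

definition square_of_side :: "real \<Rightarrow> (real \<times> real) set \<Rightarrow> bool" where
  "square_of_side s Q \<longleftrightarrow> s > 0 \<and> (\<exists>x y. Q = {x..x + s} \<times> {y..y + s})"

definition adjacent :: "(real \<times> real) set \<Rightarrow> (real \<times> real) set \<Rightarrow> bool" where
  "adjacent Q1 Q2 \<longleftrightarrow> Q1 \<inter> Q2 \<noteq> {}"

(* The measure may live on a sigma-algebra larger than the Borel one (e.g. the
   completion, or the Caratheodory sets of a Borel regular outer measure). *)
definition borel_regular_on :: "'a::topological_space set \<Rightarrow> 'a measure \<Rightarrow> bool" where
  "borel_regular_on S M \<longleftrightarrow>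
     space M = S \<and>
     sets (restrict_space borel S) \<subseteq> sets M \<and>
     (\<forall>A\<in>sets M. \<exists>B\<in>sets (restrict_space borel S). A \<subseteq> B \<and> emeasure M B = emeasure M A)"

definition doubling_constant :: "(real \<times> real) measure \<Rightarrow> real \<Rightarrow> bool" where
  "doubling_constant M C \<longleftrightarrow>
     (\<forall>s Q1 Q2. square_of_side s Q1 \<and> square_of_side s Q2 \<and>
        Q1 \<subseteq> unit_square \<and> Q2 \<subseteq> unit_square \<and> adjacent Q1 Q2 \<longrightarrow>
        0 < emeasure M Q1 \<and>
        emeasure M Q1 \<le> ennreal C * emeasure M Q2 \<and>
        ennreal C * emeasure M Q2 < \<infinity>)"

definition doubling_measure :: "(real \<times> real) measure \<Rightarrow> bool" where
  "doubling_measure M \<longleftrightarrow> borel_regular_on unit_square M \<and> (\<exists>C. doubling_constant M C)"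

definition graph_on_unit :: "(real \<Rightarrow> real) \<Rightarrow> (real \<times> real) set" where
  "graph_on_unit f = {(x, f x) | x. x \<in> {0..1}}"

end

theory Submission
  imports Defs
begin

text \<open>
  Fix a small \<open>a > 0\<close>. Choose the height \<open>t\<close> uniformly in \<open>[0, 1]\<close> and, given \<open>t\<close>, choose the base-4
  digits of \<open>x\<close> independently, giving the two middle digits weight \<open>(1 + b) / 4\<close> and the two outer
  ones weight \<open>(1 - b) / 4\<close>, where \<open>b = a * t\<close>. By the law of large numbers the digit statistics of
  \<open>x\<close> determine \<open>b\<close>, hence \<open>t\<close>, almost surely, so the resulting measure lives on the graph of a
  function; inner regularity and Tietze's theorem make that function continuous at the cost of a
  small set. The doubling constant is close to 1 for two reasons. As the weights are symmetric and
  the outer digits weigh the same, neighbouring 4-adic intervals of the same level have mass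
  ratio at most \<open>(1 + b) / (1 - b)\<close>. At scale \<open>s\<close>, about \<open>4\<^sup>-\<^sup>n\<close>, only \<open>n\<close> digits matter, while
  \<open>b\<close> varies by at most \<open>2 * a * s\<close>, so the change of the mass with \<open>t\<close> is
  a factor of at most \<open>(1 + 2 * a * 4\<^sup>-\<^sup>n)\<^sup>n\<close>.
\<close>

section \<open>The weights of 4-adic intervals\<close>

definition sign4 :: "nat \<Rightarrow> real" where
  "sign4 i = (if i mod 4 \<in> {1, 2} then 1 else - 1)"

(* The i-th 4-adic interval of level n gets mass wt b n i / 4 ^ n; the recursion strips the last
   base-4 digit of i. *)
primrec wt :: "real \<Rightarrow> nat \<Rightarrow> nat \<Rightarrow> real" where
  "wt b 0 i = 1"
| "wt b (Suc n) i = (1 + b * sign4 i) * wt b n (i div 4)"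

text \<open>\<open>cum b n i / 4 ^ n\<close> is the mass of \<open>[0, i / 4 ^ n]\<close>. As
  \<open>wt b n i\<close> depends on \<open>i\<close> only modulo \<open>4 ^ n\<close>, the mass is
  continued periodically beyond \<open>[0, 1]\<close>, and all cells of the half-line are treated
  alike.\<close>

definition cum :: "real \<Rightarrow> nat \<Rightarrow> nat \<Rightarrow> real" where
  "cum b n i = (\<Sum>q<i. wt b n q)"

lemma abs_sign4 [simp]: "\<bar>sign4 i\<bar> = 1"
  by (simp add: sign4_def)

lemma sign4_eq: "sign4 i = 1 \<or> sign4 i = - 1"
  by (simp add: sign4_def)

lemma sign4_mult4 [simp]:
  "sign4 (4 * i) = - 1" "sign4 (4 * i + 1) = 1" "sign4 (4 * i + 2) = 1" "sign4 (4 * i + 3) = - 1"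
  by (simp_all add: sign4_def mod_Suc)

lemma sum_lessThan_mult4:
  fixes f :: "nat \<Rightarrow> 'a::comm_monoid_add"
  shows "(\<Sum>q<4 * i. f q) = (\<Sum>q<i. f (4 * q) + f (4 * q + 1) + f (4 * q + 2) + f (4 * q + 3))"
proof (induction i)
  case (Suc i)
  have "{..<4 * Suc i} = insert (4*i+3) (insert (4*i+2) (insert (4*i+1) (insert (4*i) {..<4*i})))"
    by auto
  then show ?case using Suc by (simp add: algebra_simps)
qed simp

lemma mult4_add_div4: "(4 * i) div 4 = i" "(4 * i + 1) div 4 = i" "(4 * i + 2) div 4 = i" "(4 * i + 3) div 4 = (i::nat)"
  by simp_all

context
  fixes b :: real
  assumes b: "0 \<le> b" "b \<le> 1/2"
begin

lemma factor_bounds: "1 - b \<le> 1 + b * sign4 i" "1 + b * sign4 i \<le> 1 + b"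
  using b sign4_eq[of i] by auto

lemma wt_pos: "0 < wt b n i"
proof (induction n arbitrary: i)
  case (Suc n)
  then show ?case using factor_bounds(1)[of i] b by (simp add: mult_pos_pos)
qed simp

lemma wt_le: "wt b n i \<le> 2 ^ n"
proof (induction n arbitrary: i)
  case (Suc n)
  then show ?case using factor_bounds[of i] b wt_pos[of n "i div 4"] by (auto intro!: mult_mono)
qed simp

text \<open>The factor \<open>b\<close> is what matters: it makes the summed error in
  \<open>abs_cum_minus_le\<close> proportional to the parameter.\<close>

lemma abs_wt_minus_1_le: "\<bar>wt b n i - 1\<bar> \<le> b * (2 ^ n - 1)"
proof (induction n arbitrary: i)
  case (Suc n)
  have "\<bar>wt b (Suc n) i - 1\<bar> \<le> \<bar>wt b n (i div 4) - 1\<bar> + \<bar>b * sign4 i * wt b n (i div 4)\<bar>"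
    by (simp add: algebra_simps)
  also have "\<bar>b * sign4 i * wt b n (i div 4)\<bar> \<le> b * 2 ^ n"
    using b wt_pos[of n "i div 4"] wt_le[of n "i div 4"] by (simp add: abs_mult mult_left_mono)
  finally show ?case using Suc[of "i div 4"] by (simp add: algebra_simps)
qed simp

lemma wt_adjacent:
  "(1 - b) * wt b n i \<le> (1 + b) * wt b n (Suc i) \<and>
   (1 - b) * wt b n (Suc i) \<le> (1 + b) * wt b n i"
proof (induction n arbitrary: i)
  case (Suc n)
  (* A carry moves the last digit from 3 to 0; both have the same weight, so the ratio is inherited. *)
  show ?case
  proof (cases "Suc i mod 4 = 0")
    case True
    then have eq: "Suc i div 4 = Suc (i div 4)" "sign4 (Suc i) = - 1" "sign4 i = - 1"
      by (auto simp: sign4_def) presburger+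
    show ?thesis using Suc[of "i div 4"] b
      unfolding wt.simps eq by (simp add: mult.left_commute)
  next
    case False
    then have eq: "Suc i div 4 = i div 4" by presburger
    have *: "(1 - b) * ((1 + b * sign4 j) * w) \<le> (1 + b) * ((1 + b * sign4 l) * w)" if "w > 0" for j l w
    proof -
      have "(1 - b) * (1 + b * sign4 j) \<le> (1 - b) * (1 + b)"
        using b by (intro mult_left_mono factor_bounds) auto
      also have "\<dots> \<le> (1 + b) * (1 + b * sign4 l)"
        using b factor_bounds(1)[of l] by (simp add: mult.commute mult_left_mono)
      finally show ?thesis using that by (simp add: mult.assoc[symmetric])
    qed
    show ?thesis unfolding wt.simps eq using * wt_pos by blast
  qed
qed (use b in auto)

end

text \<open>The leading \<open>n\<close> digits and the trailing \<open>k\<close> digits contribute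
  separate factors, so the coarse mass of a cell can be told apart from the distribution inside
  it.\<close>

lemma wt_add: "wt b (n + k) i = wt b n (i div 4 ^ k) * wt b k i"
  by (induction k arbitrary: i) (auto simp: div_mult2_eq)

text \<open>Each of the \<open>n\<close> factors is at least \<open>1/2\<close> and moves by at most
  \<open>d\<close>, hence by a ratio of at most \<open>1 + 2 * d\<close>.\<close>

lemma wt_perturb:
  assumes "0 \<le> b" "b \<le> 1/2" "0 \<le> b'" "b' \<le> 1/2" "\<bar>b - b'\<bar> \<le> d"
  shows "wt b n i \<le> (1 + 2 * d) ^ n * wt b' n i"
proof (induction n arbitrary: i)
  case (Suc n)
  have "1 + b * sign4 i \<le> (1 + 2 * d) * (1 + b' * sign4 i)"
  proof -
    have "d \<le> 2 * d * (1 + b' * sign4 i)"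
      using factor_bounds(1)[OF assms(3,4), of i] assms mult_left_mono[of "1/2" "1 + b' * sign4 i" "2*d"] by auto
    moreover have "b * sign4 i \<le> b' * sign4 i + d" using sign4_eq[of i] assms(5) by auto
    ultimately show ?thesis by (simp add: algebra_simps)
  qed
  then have "wt b (Suc n) i \<le> ((1 + 2 * d) * (1 + b' * sign4 i)) * ((1 + 2 * d) ^ n * wt b' n (i div 4))"
    unfolding wt.simps using assms factor_bounds(1)[OF assms(1,2), of i] wt_pos[OF assms(1,2), of n "i div 4"]
      factor_bounds(1)[OF assms(3,4), of i]
    by (intro mult_mono Suc) auto
  then show ?case by (simp add: ac_simps)
qed simp

section \<open>Cumulative masses\<close>

lemma cum_Suc [simp]: "cum b n (Suc i) = cum b n i + wt b n i"
  by (simp add: cum_def)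

lemma cum_0 [simp]: "cum b n 0 = 0" "cum b 0 i = i"
  by (simp_all add: cum_def)

text \<open>Refining a cell preserves its mass: the factors of the four digits,
  \<open>1 - b\<close>, \<open>1 + b\<close>, \<open>1 + b\<close> and \<open>1 - b\<close>, add up
  to 4.\<close>

lemma cum_mult4: "cum b (Suc n) (4 * i) = 4 * cum b n i"
proof -
  have "wt b (Suc n) (4 * q) + wt b (Suc n) (4 * q + 1) + wt b (Suc n) (4 * q + 2) + wt b (Suc n) (4 * q + 3)
      = 4 * wt b n q" for q
    unfolding wt.simps mult4_add_div4 sign4_mult4 by (simp add: algebra_simps)
  then show ?thesis unfolding cum_def sum_lessThan_mult4 sum_distrib_left by presburger
qed

lemma cum_mult_power4: "cum b (n + k) (4 ^ k * i) = 4 ^ k * cum b n i"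
proof (induction k)
  case (Suc k)
  have "cum b (n + Suc k) (4 ^ Suc k * i) = 4 * cum b (n + k) (4 ^ k * i)"
    using cum_mult4[of b "n + k" "4 ^ k * i"] by (simp add: mult.assoc)
  then show ?case using Suc by simp
qed simp

context
  fixes b :: real
  assumes b: "0 \<le> b" "b \<le> 1/2"
begin

lemma cum_mono: "i \<le> j \<Longrightarrow> cum b n i \<le> cum b n j"
  unfolding cum_def using wt_pos[OF b] by (intro sum_mono2) (auto intro: less_imp_le)

text \<open>The error quadruples from level \<open>n\<close> to the next at multiples of 4, and at
  most three further cells add \<open>2 * b * 2 ^ n\<close> each. After division by
  \<open>4 ^ n\<close> it stays below \<open>3 * b\<close> at every level, so the measure is close
  to Lebesgue measure for small \<open>b\<close>.\<close>

lemma abs_cum_minus_le: "\<bar>cum b n i - i\<bar> \<le> 3 * b * (4 ^ n - 2 ^ n)"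
proof (induction n arbitrary: i)
  case (Suc n)
  let ?w = "\<lambda>q. wt b (Suc n) q"
  have *: "\<bar>?w q - 1\<bar> \<le> 2 * b * 2 ^ n" for q
    using abs_wt_minus_1_le[OF b, of "Suc n" q] b by (simp add: algebra_simps)
  define j where "j = i div 4"
  have "\<exists>d<4. i = 4 * j + d" unfolding j_def by (intro exI[of _ "i mod 4"]) auto
  then have "i = 4 * j \<or> i = Suc (4 * j) \<or> i = Suc (Suc (4 * j)) \<or> i = Suc (Suc (Suc (4 * j)))" by auto
  then have "\<bar>cum b (Suc n) i - i\<bar> \<le> \<bar>cum b (Suc n) (4 * j) - 4 * j\<bar> + 3 * (2 * b * 2 ^ n)"
    using *[of "4 * j"] *[of "Suc (4 * j)"] *[of "Suc (Suc (4 * j))"]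
    by (elim disjE) (simp_all del: wt.simps)
  also have "\<bar>cum b (Suc n) (4 * j) - 4 * j\<bar> = 4 * \<bar>cum b n j - j\<bar>"
    unfolding cum_mult4 by (simp add: abs_if)
  finally show ?case using Suc[of j] by (simp add: algebra_simps)
qed simp

end

section \<open>The distribution function\<close>

definition cell :: "nat \<Rightarrow> real \<Rightarrow> nat" where
  "cell n x = nat \<lfloor>4 ^ n * x\<rfloor>"

text \<open>The mass of \<open>[0, x]\<close>, approximated from below by the cells of level
  \<open>n\<close> to the left of the one that contains \<open>x\<close>.\<close>

definition distr_fun :: "real \<Rightarrow> real \<Rightarrow> real" where
  "distr_fun b x = lim (\<lambda>n. cum b n (cell n x) / 4 ^ n)"

lemma cell_bounds:
  assumes "0 \<le> x"
  shows "real (cell n x) \<le> 4 ^ n * x" "4 ^ n * x < real (cell n x) + 1"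
  using assms unfolding cell_def by (simp_all add: of_nat_floor)

lemma cell_mono: "x \<le> y \<Longrightarrow> cell n x \<le> cell n y"
  unfolding cell_def by (intro nat_mono floor_mono) simp

lemma cell_eqI: "real i \<le> 4 ^ n * x \<Longrightarrow> 4 ^ n * x < real i + 1 \<Longrightarrow> cell n x = i"
  unfolding cell_def by (simp add: nat_eq_iff) linarith

lemma cell_add_div:
  assumes "0 \<le> x" shows "cell (n + k) x div 4 ^ k = cell n x"
proof (rule cell_eqI[symmetric])
  let ?q = "cell (n + k) x div 4 ^ k"
  note c = cell_bounds[OF assms, of "n + k"]
  have "?q * 4 ^ k \<le> cell (n + k) x" "Suc (cell (n + k) x) \<le> (?q + 1) * 4 ^ k"
    by (simp_all add: div_times_less_eq_dividend dividend_less_div_times Suc_le_eq)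
  then have "real (?q * 4 ^ k) \<le> real (cell (n + k) x)" "real (Suc (cell (n + k) x)) \<le> real ((?q + 1) * 4 ^ k)"
    by (simp_all only: of_nat_le_iff)
  then have "real ?q * 4 ^ k \<le> real (cell (n + k) x)" "real (cell (n + k) x) + 1 \<le> (real ?q + 1) * 4 ^ k"
    by (simp_all add: algebra_simps)
  moreover have "4 ^ (n + k) * x = (4 ^ n * x) * 4 ^ k" by (simp add: power_add)
  ultimately have "real ?q * 4 ^ k \<le> (4 ^ n * x) * 4 ^ k" "(4 ^ n * x) * 4 ^ k < (real ?q + 1) * 4 ^ k"
    using c by linarith+
  then show "real ?q \<le> 4 ^ n * x" "4 ^ n * x < real ?q + 1"
    by (auto dest: mult_right_le_imp_le mult_right_less_imp_less)
qed

lemma cell_of_grid: "cell (n + k) (real i / 4 ^ n) = 4 ^ k * i"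
  by (rule cell_eqI) (simp_all add: power_add)

context
  fixes b :: real
  assumes b: "0 \<le> b" "b \<le> 1/2"
begin

lemma cum_cell_incseq:
  assumes "0 \<le> x" shows "incseq (\<lambda>n. cum b n (cell n x) / 4 ^ n)"
proof (rule incseq_SucI)
  fix n
  have "4 * cell n x \<le> cell (Suc n) x"
    using cell_add_div[OF assms, of n 1] times_div_less_eq_dividend[of 4 "cell (Suc n) x"] by simp
  from cum_mono[OF b this, of "Suc n"]
  show "cum b n (cell n x) / 4 ^ n \<le> cum b (Suc n) (cell (Suc n) x) / 4 ^ Suc n"
    unfolding cum_mult4 by (simp add: field_simps)
qed

lemma distr_fun_LIMSEQ:
  assumes "0 \<le> x" shows "(\<lambda>n. cum b n (cell n x) / 4 ^ n) \<longlonglongrightarrow> distr_fun b x"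
proof -
  \<comment> \<open>An integer has its exact cumulative mass at every level, so the integer above
    \<open>x\<close> bounds the increasing sequence.\<close>
  have "cum b n (cell n x) / 4 ^ n \<le> nat \<lceil>x\<rceil>" for n
  proof -
    have "cell n x \<le> cell (0 + n) (real (nat \<lceil>x\<rceil>) / 4 ^ 0)"
      unfolding add_0 using assms by (intro cell_mono) (simp add: le_of_int_ceiling)
    from cum_mono[OF b this, of "0 + n"] show ?thesis
      unfolding cell_of_grid cum_mult_power4 by (simp add: field_simps)
  qed
  then have "convergent (\<lambda>n. cum b n (cell n x) / 4 ^ n)"
    using incseq_convergent[OF cum_cell_incseq[OF assms], of "real (nat \<lceil>x\<rceil>)"]
    unfolding convergent_def by blast
  then show ?thesis unfolding distr_fun_def by (simp add: convergent_LIMSEQ_iff)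
qed

lemma distr_fun_mono: "0 \<le> x \<Longrightarrow> x \<le> y \<Longrightarrow> distr_fun b x \<le> distr_fun b y"
  by (rule LIMSEQ_le[OF distr_fun_LIMSEQ distr_fun_LIMSEQ])
    (auto intro!: exI divide_right_mono cum_mono[OF b] cell_mono)

text \<open>By mass preservation under refinement, the approximations at a grid point of level
  \<open>n\<close> are constant from level \<open>n\<close> on.\<close>

lemma distr_fun_grid: "distr_fun b (real i / 4 ^ n) = cum b n i / 4 ^ n"
proof -
  have "(\<lambda>k. cum b (k + n) (cell (k + n) (real i / 4 ^ n)) / 4 ^ (k + n)) \<longlonglongrightarrow> distr_fun b (real i / 4 ^ n)"
    using LIMSEQ_ignore_initial_segment[OF distr_fun_LIMSEQ] by simp
  moreover have "cum b (k + n) (cell (k + n) (real i / 4 ^ n)) / 4 ^ (k + n) = cum b n i / 4 ^ n" for k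
    using cell_of_grid[of n k i] cum_mult_power4[of b n k i] by (simp add: add.commute power_add)
  ultimately show ?thesis by (simp add: LIMSEQ_const_iff)
qed

lemma distr_fun_0 [simp]: "distr_fun b 0 = 0" and distr_fun_1 [simp]: "distr_fun b 1 = 1"
  using distr_fun_grid[of 0 0] distr_fun_grid[of 1 0] by simp_all

text \<open>A single cell has mass at most \<open>2 ^ n / 4 ^ n\<close>. The error is uniform in
  \<open>x\<close> and \<open>b\<close>, which yields continuity in either variable.\<close>

lemma distr_fun_cell:
  assumes "0 \<le> x"
  shows "cum b n (cell n x) / 4 ^ n \<le> distr_fun b x" "distr_fun b x \<le> cum b n (cell n x) / 4 ^ n + 1 / 2 ^ n"
proof -
  note c = cell_bounds[OF assms, of n]
  show "cum b n (cell n x) / 4 ^ n \<le> distr_fun b x"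
    using distr_fun_mono[of "real (cell n x) / 4 ^ n" x] c by (simp add: distr_fun_grid field_simps)
  have "distr_fun b x \<le> distr_fun b (real (Suc (cell n x)) / 4 ^ n)"
    using c by (intro distr_fun_mono assms) (simp add: field_simps)
  also have "\<dots> = cum b n (cell n x) / 4 ^ n + wt b n (cell n x) / 4 ^ n"
    unfolding distr_fun_grid by (simp add: add_divide_distrib)
  also have "wt b n (cell n x) / 4 ^ n \<le> 2 ^ n / 4 ^ n"
    by (intro divide_right_mono wt_le[OF b]) simp
  also have "\<dots> = 1 / (2::real) ^ n" by (simp add: power_divide[symmetric] power_one_over)
  finally show "distr_fun b x \<le> cum b n (cell n x) / 4 ^ n + 1 / 2 ^ n" by simp
qed

text \<open>Points at distance below \<open>1 / 4 ^ n\<close> lie in the same or in neighbouring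
  cells. The modulus is independent of \<open>b\<close>, as joint continuity demands.\<close>

lemma distr_fun_modulus:
  assumes "0 \<le> x" "x \<le> y" "4 ^ n * (y - x) < 1"
  shows "distr_fun b y \<le> distr_fun b x + 2 / 2 ^ n"
proof -
  have "real (cell n y) < real (cell n x) + 2"
    using cell_bounds[of x n] cell_bounds[of y n] assms by (simp add: algebra_simps)
  then have "cell n y \<le> Suc (cell n x)" by linarith
  then have "cum b n (cell n y) / 4 ^ n \<le> (cum b n (cell n x) + wt b n (cell n x)) / 4 ^ n"
    using cum_mono[OF b, of "cell n y" "Suc (cell n x)" n] by (intro divide_right_mono) auto
  also have "\<dots> \<le> cum b n (cell n x) / 4 ^ n + 2 ^ n / 4 ^ n"
    using wt_le[OF b, of n "cell n x"] by (simp add: add_divide_distrib divide_right_mono)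
  also have "2 ^ n / 4 ^ n = 1 / (2::real) ^ n" by (simp add: power_divide[symmetric] power_one_over)
  finally show ?thesis using distr_fun_cell(2)[of y n] distr_fun_cell(1)[of x n] assms by simp
qed

text \<open>Between \<open>x\<close> and \<open>y\<close> lies a complete cell of a fine enough
  level, and every cell has positive mass.\<close>

lemma distr_fun_strict_mono:
  assumes "0 \<le> x" "x < y" shows "distr_fun b x < distr_fun b y"
proof -
  obtain n where n: "2 / (y - x) < 4 ^ n"
    using real_arch_pow[of 4] by auto
  define i where "i = Suc (cell n x)"
  have "x \<le> real i / 4 ^ n" using cell_bounds[OF assms(1), of n] by (simp add: i_def field_simps)
  moreover have "real (Suc i) / 4 ^ n \<le> y"
    using cell_bounds(1)[OF assms(1), of n] n assms by (simp add: i_def field_simps)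
  ultimately have "distr_fun b x \<le> distr_fun b (real i / 4 ^ n)" "distr_fun b (real (Suc i) / 4 ^ n) \<le> distr_fun b y"
    using assms by (auto intro: distr_fun_mono)
  moreover have "distr_fun b (real i / 4 ^ n) < distr_fun b (real (Suc i) / 4 ^ n)"
    unfolding distr_fun_grid using wt_pos[OF b, of n i] by (simp add: divide_strict_right_mono)
  ultimately show ?thesis by simp
qed

end

section \<open>Continuity in the parameter and joint continuity\<close>

lemma continuous_wt: "continuous_on S (\<lambda>b. wt b n i)"
  by (induction n arbitrary: i) (auto intro!: continuous_intros)

text \<open>For fixed \<open>x\<close> the approximations are polynomials in \<open>b\<close> that
  converge uniformly at rate \<open>1 / 2 ^ n\<close>.\<close>

lemma continuous_distr_fun_param:
  assumes "0 \<le> x" shows "continuous_on {0..1/2} (\<lambda>b. distr_fun b x)"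
proof (rule uniform_limit_theorem[where F=sequentially])
  show "\<forall>\<^sub>F n in sequentially. continuous_on {0..1/2} (\<lambda>b. cum b n (cell n x) / 4 ^ n)"
    unfolding cum_def by (intro always_eventually allI continuous_intros continuous_wt) auto
  show "uniform_limit {0..1/2} (\<lambda>n b. cum b n (cell n x) / 4 ^ n) (\<lambda>b. distr_fun b x) sequentially"
  proof (rule uniform_limitI)
    fix e :: real assume "e > 0"
    have "(\<lambda>n. 1 / (2::real) ^ n) \<longlonglongrightarrow> 0"
      using LIMSEQ_power_zero[of "1/2::real"] by (simp add: power_one_over)
    then have "\<forall>\<^sub>F n in sequentially. 1 / (2::real) ^ n < e"
      using \<open>e > 0\<close> order_tendstoD(2) by blast
    then show "\<forall>\<^sub>F n in sequentially. \<forall>b\<in>{0..1/2}. dist (cum b n (cell n x) / 4 ^ n) (distr_fun b x) < e"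
    proof eventually_elim
      case (elim n)
      show ?case
      proof
        fix b :: real assume "b \<in> {0..1/2}"
        then have "0 \<le> b" "b \<le> 1/2" by auto
        from distr_fun_cell[OF this assms, of n] elim
        show "dist (cum b n (cell n x) / 4 ^ n) (distr_fun b x) < e"
          unfolding dist_real_def by linarith
      qed
    qed
  qed
qed simp

text \<open>First the position moves at the new parameter, controlled by the modulus that is uniform
  in \<open>b\<close>; then the parameter moves at the old position.\<close>

lemma continuous_distr_fun: "continuous_on ({0..1/2} \<times> {0..}) (\<lambda>(b, x). distr_fun b x)"
  unfolding continuous_on_iff
proof (rule, rule, rule)
  fix p :: "real \<times> real" and e :: real assume p: "p \<in> {0..1/2} \<times> {0..}" and e: "0 < e"
  define b x where "b = fst p" and "x = snd p"
  have b: "b \<in> {0..1/2}" and x: "0 \<le> x" and p_eq: "p = (b, x)"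
    using p unfolding b_def x_def mem_Times_iff atLeast_iff prod.collapse by simp_all
  obtain n where n: "4 / e < 2 ^ n" using real_arch_pow[of 2 "4 / e"] by auto
  have "0 < e / 2" using e by simp
  then obtain d where d: "d > 0"
      "\<And>b'. b' \<in> {0..1/2} \<Longrightarrow> dist b' b < d \<Longrightarrow> dist (distr_fun b' x) (distr_fun b x) < e / 2"
    using continuous_distr_fun_param[OF x] b unfolding continuous_on_iff by blast
  have 1: "dist (distr_fun b' x') (distr_fun b' x) < e / 2"
    if b': "b' \<in> {0..1/2}" and x': "0 \<le> x'" "dist x' x < 1 / 4 ^ n" for b' x'
  proof -
    have b'': "0 \<le> b'" "b' \<le> 1/2" using b' by auto
    have *: "4 ^ n * \<bar>x' - x\<bar> < 1" using x' by (simp add: dist_real_def field_simps)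
    have "2 / 2 ^ n < e / 2" using n e by (simp add: field_simps)
    then show ?thesis
      using distr_fun_modulus[OF b'', of x x' n] distr_fun_modulus[OF b'', of x' x n]
        distr_fun_mono[OF b'', of x x'] distr_fun_mono[OF b'', of x' x] * x x'
      unfolding dist_real_def by (cases "x \<le> x'") (simp_all add: abs_if split: if_splits)
  qed
  show "\<exists>d>0. \<forall>q\<in>{0..1/2} \<times> {0..}. dist q p < d \<longrightarrow>
      dist (case q of (b, x) \<Rightarrow> distr_fun b x) (case p of (b, x) \<Rightarrow> distr_fun b x) < e"
  proof (intro exI[of _ "min d (1 / 4 ^ n)"] conjI ballI impI)
    fix q assume q: "q \<in> {0..1/2} \<times> {0::real..}" "dist q p < min d (1 / 4 ^ n)"
    then have "dist (fst q) b < d" "dist (snd q) x < 1 / 4 ^ n"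
      using dist_fst_le[of q p] dist_snd_le[of q p] by (auto simp: b_def x_def)
    then have "dist (distr_fun (fst q) (snd q)) (distr_fun (fst q) x) < e / 2"
        "dist (distr_fun (fst q) x) (distr_fun b x) < e / 2"
      using q(1) by (auto intro!: 1 d(2) simp del: divide_const_simps)
    then show "dist (case q of (b, x) \<Rightarrow> distr_fun b x) (case p of (b, x) \<Rightarrow> distr_fun b x) < e"
      using dist_triangle[of "distr_fun (fst q) (snd q)" "distr_fun b x" "distr_fun (fst q) x"]
      by (simp add: p_eq split_beta)
  qed (use d in auto)
qed

section \<open>Increments at comparable positions and parameters\<close>

context
  fixes b :: real
  assumes b: "0 \<le> b" "b \<le> 1/2"
begin

lemma cum_diff: "i \<le> j \<Longrightarrow> cum b n j - cum b n i = (\<Sum>q\<in>{i..<j}. wt b n q)"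
  unfolding cum_def by (simp add: sum_diff_nat_ivl lessThan_atLeast0)

text \<open>The leading \<open>n\<close> digits contribute factors between \<open>m\<close> and
  \<open>M\<close>. The trailing \<open>k\<close> digits contribute a cumulative mass that differs
  from counting cells by at most \<open>3 * b * 4 ^ k\<close> at each of the two ends.\<close>

lemma cum_increment_bounds:
  assumes m: "0 \<le> m" "\<And>q. q \<in> {i div 4 ^ k..j div 4 ^ k} \<Longrightarrow> m \<le> wt b n q \<and> wt b n q \<le> M"
    and ij: "i \<le> j"
  shows "cum b (n + k) j - cum b (n + k) i \<le> M * (real j - real i + 6 * b * 4 ^ k)"
    and "m * (real j - real i - 6 * b * 4 ^ k) \<le> cum b (n + k) j - cum b (n + k) i"
proof -
  have err: "\<bar>cum b k q - q\<bar> \<le> 3 * b * 4 ^ k" for q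
    using abs_cum_minus_le[OF b, of k q] mult_left_mono[of "4 ^ k - 2 ^ k" "4 ^ k" "3 * b"] b by force
  have w: "m * wt b k q \<le> wt b (n + k) q \<and> wt b (n + k) q \<le> M * wt b k q" if "q \<in> {i..<j}" for q
    unfolding wt_add using that wt_pos[OF b, of k q]
    by (auto intro!: mult_right_mono m(2)[THEN conjunct1] m(2)[THEN conjunct2] simp: div_le_mono)
  have "0 \<le> M" using m(1) m(2)[of "j div 4 ^ k"] ij by (auto simp: div_le_mono)
  have "cum b (n + k) j - cum b (n + k) i \<le> M * (cum b k j - cum b k i)"
    unfolding cum_diff[OF ij] sum_distrib_left using w by (intro sum_mono) auto
  also have "\<dots> \<le> M * (real j - real i + 6 * b * 4 ^ k)"
    using err[of i] err[of j] \<open>0 \<le> M\<close> by (intro mult_left_mono) (auto simp: abs_le_iff)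
  finally show "cum b (n + k) j - cum b (n + k) i \<le> M * (real j - real i + 6 * b * 4 ^ k)" .
  have "m * (real j - real i - 6 * b * 4 ^ k) \<le> m * (cum b k j - cum b k i)"
    using err[of i] err[of j] m(1) by (intro mult_left_mono) (auto simp: abs_le_iff)
  also have "\<dots> \<le> cum b (n + k) j - cum b (n + k) i"
    unfolding cum_diff[OF ij] sum_distrib_left using w by (intro sum_mono) auto
  finally show "m * (real j - real i - 6 * b * 4 ^ k) \<le> cum b (n + k) j - cum b (n + k) i" .
qed

text \<open>The discrete bounds, divided by \<open>4 ^ (n + k)\<close>, in the limit of large
  \<open>k\<close>: replacing \<open>x\<close> and \<open>y\<close> by their cells costs at most
  \<open>1 / 4 ^ (n + k)\<close>, which vanishes.\<close>

lemma distr_fun_increment_bounds: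
  assumes m: "0 \<le> m" "\<And>q. q \<in> {cell n x..cell n y} \<Longrightarrow> m \<le> wt b n q \<and> wt b n q \<le> M"
    and xy: "0 \<le> x" "x \<le> y"
  shows "distr_fun b y - distr_fun b x \<le> M * (y - x + 6 * b / 4 ^ n)"
    and "m * (y - x - 6 * b / 4 ^ n) \<le> distr_fun b y - distr_fun b x"
proof -
  have "0 \<le> y" using xy by simp
  define D where "D k = cum b (n + k) (cell (n + k) y) / 4 ^ (n + k) - cum b (n + k) (cell (n + k) x) / 4 ^ (n + k)" for k
  have lim: "D \<longlonglongrightarrow> distr_fun b y - distr_fun b x"
    unfolding D_def using xy
    by (intro tendsto_diff distr_fun_LIMSEQ[OF b, THEN LIMSEQ_ignore_initial_segment, of _ n, unfolded add.commute[of _ n]])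
       auto
  have "0 \<le> M" using m(1) m(2)[of "cell n y"] cell_mono[OF xy(2), of n] by auto
  have D: "D k \<le> M * (y - x + 6 * b / 4 ^ n + 1 / 4 ^ (n + k))"
    "m * (y - x - 6 * b / 4 ^ n - 1 / 4 ^ (n + k)) \<le> D k" for k
  proof -
    let ?i = "cell (n + k) x" and ?j = "cell (n + k) y"
    have *: "m \<le> wt b n q \<and> wt b n q \<le> M" if "q \<in> {?i div 4 ^ k..?j div 4 ^ k}" for q
      using m(2) that unfolding cell_add_div[OF \<open>0 \<le> x\<close>] cell_add_div[OF \<open>0 \<le> y\<close>] .
    note C = cum_increment_bounds[OF m(1) *, OF _ cell_mono[OF xy(2), of "n + k"], simplified]
    note c = cell_bounds[OF \<open>0 \<le> x\<close>, of "n + k"] cell_bounds[OF \<open>0 \<le> y\<close>, of "n + k"]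
    have D: "D k = (cum b (n + k) ?j - cum b (n + k) ?i) / 4 ^ (n + k)"
      by (simp add: D_def diff_divide_distrib)
    have "D k \<le> M * (real ?j - real ?i + 6 * b * 4 ^ k) / 4 ^ (n + k)"
      unfolding D by (intro divide_right_mono C) auto
    also have "\<dots> \<le> M * (4 ^ (n + k) * (y - x) + 1 + 6 * b * 4 ^ k) / 4 ^ (n + k)"
      using c \<open>0 \<le> M\<close> by (intro divide_right_mono mult_left_mono) (auto simp: right_diff_distrib)
    also have "\<dots> = M * (y - x + 6 * b / 4 ^ n + 1 / 4 ^ (n + k))"
      by (simp add: field_simps power_add)
    finally show "D k \<le> M * (y - x + 6 * b / 4 ^ n + 1 / 4 ^ (n + k))" .
    have "m * (y - x - 6 * b / 4 ^ n - 1 / 4 ^ (n + k)) = m * (4 ^ (n + k) * (y - x) - 1 - 6 * b * 4 ^ k) / 4 ^ (n + k)"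
      by (simp add: field_simps power_add)
    also have "\<dots> \<le> m * (real ?j - real ?i - 6 * b * 4 ^ k) / 4 ^ (n + k)"
      using c m(1) by (intro divide_right_mono mult_left_mono) (auto simp: right_diff_distrib)
    also have "\<dots> \<le> D k"
      unfolding D by (intro divide_right_mono C) auto
    finally show "m * (y - x - 6 * b / 4 ^ n - 1 / 4 ^ (n + k)) \<le> D k" .
  qed
  have "(\<lambda>k. (1/4::real) ^ (n + k)) \<longlonglongrightarrow> 0"
    using LIMSEQ_ignore_initial_segment[OF LIMSEQ_power_zero[of "1/4::real"], of n]
    by (simp add: add.commute)
  then have z: "(\<lambda>k. 1 / (4::real) ^ (n + k)) \<longlonglongrightarrow> 0" by (simp add: power_one_over)
  have "(\<lambda>k. M * (y - x + 6 * b / 4 ^ n + 1 / 4 ^ (n + k))) \<longlonglongrightarrow> M * (y - x + 6 * b / 4 ^ n + 0)"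
    by (intro tendsto_intros z)
  from LIMSEQ_le[OF lim this] D(1)
  show "distr_fun b y - distr_fun b x \<le> M * (y - x + 6 * b / 4 ^ n)" by auto
  have "(\<lambda>k. m * (y - x - 6 * b / 4 ^ n - 1 / 4 ^ (n + k))) \<longlonglongrightarrow> m * (y - x - 6 * b / 4 ^ n - 0)"
    by (intro tendsto_intros z)
  from LIMSEQ_le[OF this lim] D(2)
  show "m * (y - x - 6 * b / 4 ^ n) \<le> distr_fun b y - distr_fun b x" by auto
qed

end

text \<open>The first factor pays for a step to a neighbouring cell, the exponential for a change of
  height within a window.\<close>

definition osc :: "real \<Rightarrow> real" where
  "osc a = (1 + a) / (1 - a) * exp (2 * a)"

lemma osc_ge_1: "0 \<le> a \<Longrightarrow> a \<le> 1/2 \<Longrightarrow> 1 \<le> osc a"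
  unfolding osc_def using mult_mono[of 1 "(1 + a) / (1 - a)" 1 "exp (2 * a)"] by (simp add: field_simps)

text \<open>The least \<open>n\<close> with cells no longer than \<open>8 * s\<close>; minimality
  means \<open>8 * s * 4 ^ (n - 1) < 1\<close>. The first property turns the error
  \<open>6 * b / 4 ^ n\<close> into at most \<open>48 * b * s\<close>; the second lets an interval
  of length \<open>2 * s\<close> meet at most two cells, level 0 being harmless because its weights
  are all 1.\<close>

lemma exists_level:
  fixes s :: real
  assumes "0 < s"
  obtains n where "1 \<le> 8 * s * 4 ^ n" "n = 0 \<or> 2 * s * 4 ^ n < 1"
proof -
  obtain n0 where "1 / (8 * s) < 4 ^ n0" using real_arch_pow[of 4] by auto
  then have ex: "\<exists>n. 1 \<le> 8 * s * 4 ^ n" using assms by (auto simp: field_simps intro!: exI[of _ n0])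
  define n where "n = (LEAST n. 1 \<le> 8 * s * 4 ^ n)"
  have "n = 0 \<or> 2 * s * 4 ^ n < 1"
  proof (cases n)
    case (Suc k)
    then have "\<not> 1 \<le> 8 * s * 4 ^ k" unfolding n_def by (metis lessI not_less_Least)
    then show ?thesis using Suc by simp
  qed simp
  then show ?thesis using that LeastI_ex[OF ex] unfolding n_def by blast
qed

text \<open>The heights differ by less than \<open>1 / 4 ^ n\<close>, hence the parameters by at
  most \<open>a / 4 ^ n\<close>. Changing the parameter in a fixed cell costs
  \<open>(1 + 2 * a / 4 ^ n) ^ n\<close>, which is at most \<open>exp (2 * a)\<close> because
  \<open>n\<close> is at most \<open>4 ^ n\<close>; then \<open>wt_adjacent\<close> moves between
  the cells at a fixed parameter.\<close>

lemma wt_window: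
  assumes a: "0 < a" "a \<le> 1/2" and t: "t0 \<in> {0..1}" "t \<in> {0..1}" "\<bar>t - t0\<bar> \<le> 2 * s"
    and n: "2 * s * 4 ^ n < 1" and i: "i = i0 \<or> i = Suc i0"
  shows "wt (a * t) n i \<le> osc a * wt (a * t0) n i0" "wt (a * t0) n i0 \<le> osc a * wt (a * t) n i"
proof -
  let ?b = "a * t" and ?e = "a * t0"
  have b: "0 \<le> ?b" "?b \<le> 1/2" and b0: "0 \<le> ?e" "?e \<le> 1/2" "?e \<le> a"
    using a t mult_mono[of a "1/2" t 1] mult_mono[of a "1/2" t0 1] mult_left_le[of t0 a] by auto
  have "\<bar>?b - ?e\<bar> = a * \<bar>t - t0\<bar>"
    by (simp only: right_diff_distrib[symmetric] abs_mult abs_of_pos[OF a(1)])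
  also have "\<dots> \<le> a * (2 * s)" using a t by (intro mult_left_mono) auto
  also have "\<dots> \<le> a * (1 / 4 ^ n)" using n a by (intro mult_left_mono) (auto simp: field_simps)
  finally have d: "\<bar>?b - ?e\<bar> \<le> a / 4 ^ n" "\<bar>?e - ?b\<bar> \<le> a / 4 ^ n" by (simp_all add: abs_minus_commute)
  have "(1 + 2 * (a / 4 ^ n)) ^ n \<le> exp (2 * (a / 4 ^ n)) ^ n"
    using a by (intro power_mono exp_ge_add_one_self) auto
  also have "\<dots> = exp (2 * a * (n / 4 ^ n))" by (simp add: exp_of_nat_mult[symmetric] ac_simps)
  also have "\<dots> \<le> exp (2 * a * 1)"
  proof -
    have "real n \<le> real (4 ^ n)" by (intro of_nat_mono less_imp_le power_gt_expt) auto
    then have "real n / 4 ^ n \<le> 1" by simp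
    then show ?thesis unfolding exp_le_cancel_iff using a by (intro mult_left_mono) auto
  qed
  finally have E: "(1 + 2 * (a / 4 ^ n)) ^ n \<le> exp (2 * a)" by simp
  have w: "0 < wt ?b n i" "0 < wt ?e n i" "0 < wt ?e n i0" using wt_pos b b0 by auto
  have p: "wt ?b n i \<le> exp (2 * a) * wt ?e n i" "wt ?e n i \<le> exp (2 * a) * wt ?b n i"
    using wt_perturb[OF b b0(1,2) d(1), of n i] wt_perturb[OF b0(1,2) b d(2), of n i]
      mult_right_mono[OF E, of "wt ?e n i"] mult_right_mono[OF E, of "wt ?b n i"] w by linarith+
  have K: "(1 + ?e) / (1 - ?e) \<le> (1 + a) / (1 - a)" using a b0 by (intro frac_le) auto
  have K1: "1 \<le> (1 + a) / (1 - a)" using a by simp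
  have "wt ?e n i \<le> (1 + ?e) / (1 - ?e) * wt ?e n i0 \<or> i = i0"
       "wt ?e n i0 \<le> (1 + ?e) / (1 - ?e) * wt ?e n i \<or> i = i0"
    using wt_adjacent[OF b0(1,2), of n i0] i b0 by (auto simp: field_simps)
  then have q: "wt ?e n i \<le> (1 + a) / (1 - a) * wt ?e n i0" "wt ?e n i0 \<le> (1 + a) / (1 - a) * wt ?e n i"
    using mult_right_mono[OF K, of "wt ?e n i0"] mult_right_mono[OF K, of "wt ?e n i"] w
      mult_right_mono[OF K1, of "wt ?e n i0"] by force+
  show "wt ?b n i \<le> osc a * wt ?e n i0"
    using p(1) mult_left_mono[OF q(1), of "exp (2 * a)"] by (simp add: osc_def ac_simps)
  show "wt ?e n i0 \<le> osc a * wt ?b n i"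
    using q(2) mult_left_mono[OF p(2), of "(1 + a) / (1 - a)"] K1 by (simp add: osc_def ac_simps)
qed

text \<open>One local density \<open>c\<close> serves all windows of width \<open>s\<close> near
  \<open>(x0, t0)\<close>: it is the weight of the cell of \<open>x0\<close> at the level from
  \<open>exists_level\<close>. Positions up to \<open>x0 + s\<close> and heights within
  \<open>2 * s\<close> leave room for two intersecting squares.\<close>

lemma distr_fun_window:
  assumes a: "0 < a" "a < 1/48" and s: "0 < s" and x0: "0 \<le> x0" and t0: "t0 \<in> {0..1}"
  obtains c where "c > 0"
    "\<And>x t. x \<in> {x0..x0 + s} \<Longrightarrow> t \<in> {0..1} \<Longrightarrow> \<bar>t - t0\<bar> \<le> 2 * s \<Longrightarrow>
       c * s * (1 - 48 * a) / osc a \<le> distr_fun (a * t) (x + s) - distr_fun (a * t) x \<and>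
       distr_fun (a * t) (x + s) - distr_fun (a * t) x \<le> osc a * c * s * (1 + 48 * a)"
proof -
  obtain n where n: "1 \<le> 8 * s * 4 ^ n" "n = 0 \<or> 2 * s * 4 ^ n < 1" using exists_level[OF s] .
  define c where "c = wt (a * t0) n (cell n x0)"
  have b01: "0 \<le> a * t \<and> a * t \<le> 1/2 \<and> a * t \<le> a" if "t \<in> {0..1}" for t
    using a that mult_mono[of a "1/2" t 1] mult_left_le[of t a] by auto
  have c: "0 < c" unfolding c_def using b01[OF t0] by (intro wt_pos) auto
  have osc: "1 \<le> osc a" using osc_ge_1 a by simp
  show ?thesis
  proof (rule that[OF c])
    fix x t assume x: "x \<in> {x0..x0 + s}" and t: "t \<in> {0..1}" "\<bar>t - t0\<bar> \<le> 2 * s"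
    have b: "0 \<le> a * t" "a * t \<le> 1/2" "a * t \<le> a" using b01[OF t(1)] by auto
    have x': "0 \<le> x" using x x0 by auto
    have W: "c / osc a \<le> wt (a * t) n q \<and> wt (a * t) n q \<le> osc a * c" if q: "q \<in> {cell n x..cell n (x + s)}" for q
    proof (cases "n = 0")
      case True
      then show ?thesis using osc by (simp add: c_def)
    next
      case False
      then have n': "2 * s * 4 ^ n < 1" using n by simp
      have "real (cell n (x + s)) < real (cell n x0) + 2"
        using cell_bounds[OF x0, of n] cell_bounds(1)[of "x + s" n] n' s x x' mult_left_mono[of "x + s" "x0 + 2 * s" "4 ^ n"]
        by (auto simp: algebra_simps)
      then have "cell n (x + s) \<le> Suc (cell n x0)" by linarith
      moreover have "cell n x0 \<le> cell n x" using x by (intro cell_mono) auto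
      ultimately have "q = cell n x0 \<or> q = Suc (cell n x0)" using q by auto
      from wt_window[OF a(1) _ t0 t n' this] a osc
      show ?thesis by (auto simp: c_def field_simps)
    qed
    have e: "6 * (a * t) / 4 ^ n \<le> 48 * a * s"
    proof -
      have "6 * (a * t) / 4 ^ n \<le> 6 * a / 4 ^ n" using b by (intro divide_right_mono) auto
      also have "\<dots> \<le> 6 * a * (8 * s)" using n(1) a by (simp add: field_simps)
      finally show ?thesis by simp
    qed
    have m: "0 \<le> c / osc a" using c osc by simp
    have "s \<ge> 0" using s by simp
    have "c * s * (1 - 48 * a) / osc a = (c / osc a) * (s - 48 * a * s)"
      by (simp add: algebra_simps diff_divide_distrib)
    also have "\<dots> \<le> (c / osc a) * (s - 6 * (a * t) / 4 ^ n)" using e m by (intro mult_left_mono) auto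
    also have "\<dots> \<le> distr_fun (a * t) (x + s) - distr_fun (a * t) x"
      using distr_fun_increment_bounds(2)[OF b(1,2) m W x', of "x + s"] s by auto
    finally have L: "c * s * (1 - 48 * a) / osc a \<le> distr_fun (a * t) (x + s) - distr_fun (a * t) x" .
    have "distr_fun (a * t) (x + s) - distr_fun (a * t) x \<le> (osc a * c) * (s + 6 * (a * t) / 4 ^ n)"
      using distr_fun_increment_bounds(1)[OF b(1,2) m W x', of "x + s"] s by auto
    also have "\<dots> \<le> (osc a * c) * (s + 48 * a * s)" using e c osc by (intro mult_left_mono) auto
    also have "\<dots> = osc a * c * s * (1 + 48 * a)" by (simp add: algebra_simps)
    finally show "c * s * (1 - 48 * a) / osc a \<le> distr_fun (a * t) (x + s) - distr_fun (a * t) x \<and>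
       distr_fun (a * t) (x + s) - distr_fun (a * t) x \<le> osc a * c * s * (1 + 48 * a)" using L by simp
  qed
qed

section \<open>Digit sums\<close>

primrec sign_sum :: "nat \<Rightarrow> nat \<Rightarrow> real" where
  "sign_sum 0 i = 0"
| "sign_sum (Suc n) i = sign4 i + sign_sum n (i div 4)"

text \<open>The signs are independent with mean \<open>b\<close> and variance
  \<open>1 - b\<^sup>2\<close>, so the variances add. In the induction the cross term cancels over
  the four values of the new digit.\<close>

lemma sign_sum_variance:
  "(\<Sum>i<4 ^ n. wt b n i * (sign_sum n i - n * b)\<^sup>2) = 4 ^ n * (n * (1 - b\<^sup>2))"
proof (induction n)
  case (Suc n)
  have split4: "(\<Sum>i<4 ^ Suc n. f i) = (\<Sum>q<4 ^ n. f (4 * q) + f (4 * q + 1) + f (4 * q + 2) + f (4 * q + 3))"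
    for f :: "nat \<Rightarrow> real"
    using sum_lessThan_mult4[of f "4 ^ n"] by simp
  have norm: "(\<Sum>q<4 ^ n. wt b n q) = 4 ^ n"
    using cum_mult_power4[of b 0 n 1] by (simp add: cum_def)
  have "(\<Sum>i<4 ^ Suc n. wt b (Suc n) i * (sign_sum (Suc n) i - Suc n * b)\<^sup>2)
      = (\<Sum>q<4 ^ n. 4 * (wt b n q * (sign_sum n q - n * b)\<^sup>2) + 4 * (1 - b\<^sup>2) * wt b n q)"
    unfolding split4 wt.simps sign_sum.simps sign4_mult4 mult4_add_div4
    by (intro sum.cong refl) (simp add: algebra_simps power2_eq_square)
  also have "\<dots> = 4 * (4 ^ n * (n * (1 - b\<^sup>2))) + 4 * (1 - b\<^sup>2) * 4 ^ n"
    unfolding sum.distrib sum_distrib_left[symmetric] Suc norm by simp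
  finally show ?case by (simp add: algebra_simps)
qed simp

lemma sign_sum_chebyshev:
  assumes b: "0 \<le> b" "b \<le> 1/2" and d: "0 < d"
  shows "(\<Sum>i | i < 4 ^ n \<and> d \<le> \<bar>sign_sum n i - n * b\<bar>. wt b n i) / 4 ^ n \<le> n / d\<^sup>2"
proof -
  let ?B = "{i. i < 4 ^ n \<and> d \<le> \<bar>sign_sum n i - n * b\<bar>}"
  have "(\<Sum>i\<in>?B. wt b n i) * d\<^sup>2 \<le> (\<Sum>i\<in>?B. wt b n i * (sign_sum n i - n * b)\<^sup>2)"
    unfolding sum_distrib_right
  proof (intro sum_mono mult_left_mono)
    fix i assume "i \<in> ?B"
    then show "d\<^sup>2 \<le> (sign_sum n i - n * b)\<^sup>2" using d by (auto simp: abs_le_square_iff[symmetric])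
  qed (use wt_pos[OF b] in \<open>auto intro: less_imp_le\<close>)
  also have "\<dots> \<le> (\<Sum>i<4 ^ n. wt b n i * (sign_sum n i - n * b)\<^sup>2)"
    using wt_pos[OF b, THEN less_imp_le] by (intro sum_mono2) auto
  also have "\<dots> \<le> 4 ^ n * (real n * 1)"
    unfolding sign_sum_variance by (intro mult_left_mono) auto
  finally show ?thesis using d by (simp add: field_simps)
qed

section \<open>The measure on the square\<close>

definition skew :: "real \<Rightarrow> real \<times> real \<Rightarrow> real \<times> real" where
  "skew a = (\<lambda>(x, t). (distr_fun (a * t) x, t))"

(* The image of Lebesgue measure under the inverse of skew: its conditional distribution function at
   height t is distr_fun (a * t). *)
definition plane_measure :: "real \<Rightarrow> (real \<times> real) measure" where
  "plane_measure a = distr (restrict_space lborel unit_square) borel (the_inv_into unit_square (skew a))"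

text \<open>Regularity is stated for a measure whose space is the square, whereas
  \<open>inner_regular\<close> is applied to \<open>plane_measure\<close>, which is defined on all
  Borel sets of the plane.\<close>

definition square_measure :: "real \<Rightarrow> (real \<times> real) measure" where
  "square_measure a = restrict_space (plane_measure a) unit_square"

lemma compact_unit_square: "compact unit_square"
  unfolding unit_square_def by (intro compact_Times compact_Icc)

lemma borel_unit_square [measurable, simp]: "unit_square \<in> sets borel"
  by (intro borel_closed compact_imp_closed compact_unit_square)

lemma distr_fun_image_Icc:
  assumes b: "0 \<le> b" "b \<le> 1/2" and x: "0 \<le> x" "x \<le> y"
  shows "distr_fun b ` {x..y} = {distr_fun b x..distr_fun b y}"
proof
  show "distr_fun b ` {x..y} \<subseteq> {distr_fun b x..distr_fun b y}"
    using x by (auto intro!: distr_fun_mono[OF b])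
  have "continuous_on {x..y} (\<lambda>x. case (b, x) of (b, x) \<Rightarrow> distr_fun b x)"
    using x b by (intro continuous_on_compose2[OF continuous_distr_fun] continuous_intros) auto
  then show "{distr_fun b x..distr_fun b y} \<subseteq> distr_fun b ` {x..y}"
    using IVT'[of "distr_fun b" x _ y] x by force
qed

context
  fixes a :: real
  assumes a: "0 < a" "a \<le> 1/2"
begin

lemma param_bounds: "t \<in> {0..1} \<Longrightarrow> 0 \<le> a * t \<and> a * t \<le> 1/2"
  using a mult_mono[of a "1/2" t 1] by auto

lemma inj_on_skew: "inj_on (skew a) unit_square"
proof (rule inj_onI, clarsimp simp: skew_def unit_square_def)
  fix x x' t assume "0 \<le> x" "0 \<le> x'" "0 \<le> t" "t \<le> 1" "distr_fun (a * t) x = distr_fun (a * t) x'"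
  then show "x = x'"
    using param_bounds[of t] distr_fun_strict_mono[of "a * t" x x'] distr_fun_strict_mono[of "a * t" x' x]
    by (cases x x' rule: linorder_cases) auto
qed

lemma skew_slice:
  "{u. (u, t) \<in> skew a ` (A \<inter> unit_square)} =
   (if t \<in> {0..1} then distr_fun (a * t) ` {x \<in> {0..1}. (x, t) \<in> A} else {})"
proof -
  have "(u, t) \<in> skew a ` (A \<inter> unit_square) \<longleftrightarrow> t \<in> {0..1} \<and> (\<exists>x\<in>{0..1}. (x, t) \<in> A \<and> u = distr_fun (a * t) x)" for u
    unfolding skew_def unit_square_def image_iff by force
  then show ?thesis by auto
qed

lemma skew_image: "skew a ` unit_square = unit_square"
proof -
  have "(u, t) \<in> skew a ` unit_square \<longleftrightarrow> (u, t) \<in> unit_square" for u t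
  proof (cases "t \<in> {0..1}")
    case True
    have "{u. (u, t) \<in> skew a ` unit_square} = distr_fun (a * t) ` {0..1}"
      using skew_slice[of t UNIV] True by (simp add: atLeastAtMost_def atLeast_def atMost_def Int_def)
    also have "\<dots> = {0..1}"
      using distr_fun_image_Icc[of "a * t" 0 1] param_bounds[OF True] by simp
    finally show ?thesis using True unfolding unit_square_def by blast
  next
    case False
    then show ?thesis using skew_slice[of t UNIV] by (auto simp: unit_square_def)
  qed
  then show ?thesis by auto
qed

lemma continuous_skew: "continuous_on unit_square (skew a)"
  unfolding skew_def split_beta
proof (intro continuous_intros)
  have "continuous_on unit_square (\<lambda>p. case (a * snd p, fst p) of (b, x) \<Rightarrow> distr_fun b x)"
    using param_bounds
    by (intro continuous_on_compose2[OF continuous_distr_fun] continuous_intros) (auto simp: unit_square_def)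
  then show "continuous_on unit_square (\<lambda>p. distr_fun (a * snd p) (fst p))" by simp
qed

text \<open>A continuous injection on a compact set has a continuous inverse on its image, which
  here is the square itself.\<close>

lemma measurable_skew_inv:
  "the_inv_into unit_square (skew a) \<in> restrict_space lborel unit_square \<rightarrow>\<^sub>M borel"
proof -
  have "continuous_on unit_square (the_inv_into unit_square (skew a))"
    using continuous_on_inv_into[OF continuous_skew compact_unit_square inj_on_skew] by (simp add: skew_image)
  from borel_measurable_continuous_on_restrict[OF this]
  show ?thesis by (simp cong: measurable_cong_sets add: sets_restrict_space)
qed

lemma skew_inv_vimage:
  "the_inv_into unit_square (skew a) -` A \<inter> unit_square = skew a ` (A \<inter> unit_square)"
proof -
  have "p \<in> the_inv_into unit_square (skew a) -` A \<inter> unit_square \<longleftrightarrow> p \<in> skew a ` (A \<inter> unit_square)" for p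
  proof (cases "p \<in> unit_square")
    case True
    then obtain q where "q \<in> unit_square" "p = skew a q" using skew_image by blast
    then show ?thesis using inj_on_skew True by (auto simp: the_inv_into_f_f dest: inj_onD)
  next
    case False
    then show ?thesis using skew_image by blast
  qed
  then show ?thesis by blast
qed

lemma skew_image_borel:
  assumes "A \<in> sets borel" shows "skew a ` (A \<inter> unit_square) \<in> sets borel"
  using measurable_sets[OF measurable_skew_inv assms]
  by (simp add: space_restrict_space skew_inv_vimage sets_restrict_space_iff)

text \<open>The preimage under the inverse is the image under \<open>skew a\<close>, and Fubini's
  theorem slices it horizontally. The conditional mass of a slice is thus the length of its image
  under the distribution function.\<close>

lemma emeasure_plane_measure:
  assumes A: "A \<in> sets borel"
  shows "emeasure (plane_measure a) A =
    (\<integral>\<^sup>+ t. emeasure lborel (distr_fun (a * t) ` {x \<in> {0..1}. (x, t) \<in> A}) * indicator {0..1} t \<partial>lborel)"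
proof -
  let ?X = "skew a ` (A \<inter> unit_square)"
  have X: "?X \<in> sets (lborel \<Otimes>\<^sub>M lborel)" using skew_image_borel[OF A] unfolding lborel_prod by simp
  have "emeasure (plane_measure a) A = emeasure (restrict_space lborel unit_square) ?X"
    unfolding plane_measure_def using A
    by (subst emeasure_distr[OF measurable_skew_inv]) (simp_all add: space_restrict_space skew_inv_vimage)
  also have "\<dots> = emeasure (lborel \<Otimes>\<^sub>M lborel) ?X"
    unfolding lborel_prod using skew_image
    by (intro emeasure_restrict_space) (auto intro!: image_mono)
  also have "\<dots> = (\<integral>\<^sup>+ t. emeasure lborel ((\<lambda>u. (u, t)) -` ?X) \<partial>lborel)"
    by (rule lborel_pair.emeasure_pair_measure_alt2[OF X])
  also have "\<dots> = (\<integral>\<^sup>+ t. emeasure lborel (distr_fun (a * t) ` {x \<in> {0..1}. (x, t) \<in> A}) * indicator {0..1} t \<partial>lborel)"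
    unfolding vimage_def skew_slice by (intro nn_integral_cong) (auto split: split_indicator)
  finally show ?thesis .
qed

lemma emeasure_plane_measure_le:
  assumes A: "A \<in> sets borel"
    and le: "\<And>t. t \<in> {0..1} \<Longrightarrow> emeasure lborel (distr_fun (a * t) ` {x \<in> {0..1}. (x, t) \<in> A}) \<le> c"
  shows "emeasure (plane_measure a) A \<le> c"
proof -
  have "emeasure (plane_measure a) A \<le> (\<integral>\<^sup>+ t. c * indicator {0..1} t \<partial>(lborel :: real measure))"
    unfolding emeasure_plane_measure[OF A] using le by (intro nn_integral_mono) (auto split: split_indicator)
  then show ?thesis by (simp add: nn_integral_cmult_indicator)
qed

text \<open>At every height in the square the slice is an interval whose conditional mass is an
  increment of the distribution function; integration over the heights contributes the second factor
  \<open>s\<close>.\<close>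

lemma emeasure_rect_bounds:
  assumes Q: "Q = {x..x + s} \<times> {y..y + s}" "Q \<subseteq> unit_square" "0 < s"
    and lu: "\<And>t. t \<in> {y..y + s} \<Longrightarrow> l \<le> distr_fun (a * t) (x + s) - distr_fun (a * t) x \<and>
        distr_fun (a * t) (x + s) - distr_fun (a * t) x \<le> u"
    and "0 \<le> l"
  shows "ennreal (l * s) \<le> emeasure (plane_measure a) Q" "emeasure (plane_measure a) Q \<le> ennreal (u * s)"
proof -
  have "(x, y) \<in> Q" "(x + s, y + s) \<in> Q" using Q by auto
  then have xy: "0 \<le> x" "x + s \<le> 1" "0 \<le> y" "y + s \<le> 1" using Q(2) by (auto simp: unit_square_def)
  have "closed Q" unfolding Q(1) by (intro closed_Times closed_atLeastAtMost)
  then have A: "Q \<in> sets borel" by (rule borel_closed)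
  have "0 \<le> u" using lu[of y] Q(3) \<open>0 \<le> l\<close> by auto
  let ?D = "\<lambda>t. distr_fun (a * t) (x + s) - distr_fun (a * t) x"
  have eq: "emeasure lborel (distr_fun (a * t) ` {x \<in> {0..1}. (x, t) \<in> Q}) * indicator {0..1} t
      = ennreal (?D t) * indicator {y..y + s} t" for t
  proof (cases "t \<in> {y..y + s}")
    case True
    then have t: "t \<in> {0..1}" using xy by auto
    have "{x \<in> {0..1}. (x, t) \<in> Q} = {x..x + s}" using True xy by (auto simp: Q(1))
    moreover have "distr_fun (a * t) x \<le> distr_fun (a * t) (x + s)"
      using param_bounds[OF t] xy Q(3) by (intro distr_fun_mono) auto
    ultimately show ?thesis
      using param_bounds[OF t] True t distr_fun_image_Icc[of "a * t" x "x + s"] xy Q(3) by simp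
  next
    case False
    then have "{x \<in> {0..1}. (x, t) \<in> Q} = {}" by (auto simp: Q(1))
    then show ?thesis using False by (simp only: image_empty emeasure_empty) simp
  qed
  have em: "emeasure (plane_measure a) Q = (\<integral>\<^sup>+ t. ennreal (?D t) * indicator {y..y + s} t \<partial>lborel)"
    unfolding emeasure_plane_measure[OF A] eq ..
  have const: "(\<integral>\<^sup>+ t. ennreal c * indicator {y..y + s} t \<partial>(lborel :: real measure)) = ennreal (c * s)" if "0 \<le> c" for c
    using that Q(3) by (simp add: nn_integral_cmult_indicator ennreal_mult)
  have "(\<integral>\<^sup>+ t. ennreal l * indicator {y..y + s} t \<partial>lborel) \<le> emeasure (plane_measure a) Q"
    unfolding em using lu by (intro nn_integral_mono) (auto split: split_indicator intro!: ennreal_leI)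
  then show "ennreal (l * s) \<le> emeasure (plane_measure a) Q" using const \<open>0 \<le> l\<close> by simp
  have "emeasure (plane_measure a) Q \<le> (\<integral>\<^sup>+ t. ennreal u * indicator {y..y + s} t \<partial>lborel)"
    unfolding em using lu by (intro nn_integral_mono) (auto split: split_indicator intro!: ennreal_leI)
  then show "emeasure (plane_measure a) Q \<le> ennreal (u * s)" using const \<open>0 \<le> u\<close> by simp
qed

end

section \<open>Regularity and the doubling constant\<close>

lemma sets_plane_measure [simp, measurable_cong]: "sets (plane_measure a) = sets borel"
  and space_plane_measure [simp]: "space (plane_measure a) = UNIV"
  by (simp_all add: plane_measure_def)

lemma sets_square_measure [simp]: "sets (square_measure a) = sets (restrict_space borel unit_square)"
  by (simp add: square_measure_def sets_restrict_space)

lemma space_square_measure [simp]: "space (square_measure a) = unit_square"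
  by (simp add: square_measure_def space_restrict_space)

lemma emeasure_square_measure:
  "A \<subseteq> unit_square \<Longrightarrow> emeasure (square_measure a) A = emeasure (plane_measure a) A"
  unfolding square_measure_def by (intro emeasure_restrict_space) auto

lemma borel_regular_on_square_measure: "borel_regular_on unit_square (square_measure a)"
  unfolding borel_regular_on_def by auto

text \<open>The quotient of the two bounds in \<open>distr_fun_window\<close>, from which
  \<open>c\<close> and \<open>s\<close> cancel.\<close>

definition doubling_bound :: "real \<Rightarrow> real" where
  "doubling_bound a = (osc a)\<^sup>2 * ((1 + 48 * a) / (1 - 48 * a))"

text \<open>Corners of intersecting squares differ by at most \<open>s\<close> in each coordinate.
  Both squares therefore fit the window at the smaller left end and the height \<open>y1\<close>,
  and share the same density \<open>c\<close>.\<close>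

lemma doubling_constant_square_measure:
  assumes a: "0 < a" "a < 1/48"
  shows "doubling_constant (square_measure a) (doubling_bound a)"
  unfolding doubling_constant_def
proof (intro allI impI)
  fix s Q1 Q2
  assume Q: "square_of_side s Q1 \<and> square_of_side s Q2 \<and> Q1 \<subseteq> unit_square \<and> Q2 \<subseteq> unit_square \<and> adjacent Q1 Q2"
  then have s: "0 < s" and sub: "Q1 \<subseteq> unit_square" "Q2 \<subseteq> unit_square" and ne: "Q1 \<inter> Q2 \<noteq> {}"
    by (simp_all add: square_of_side_def adjacent_def)
  obtain x1 y1 where Q1: "Q1 = {x1..x1 + s} \<times> {y1..y1 + s}"
    using Q unfolding square_of_side_def by auto
  obtain x2 y2 where Q2: "Q2 = {x2..x2 + s} \<times> {y2..y2 + s}"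
    using Q unfolding square_of_side_def by auto
  have "(x1, y1) \<in> Q1" "(x1 + s, y1 + s) \<in> Q1" "(x2, y2) \<in> Q2" "(x2 + s, y2 + s) \<in> Q2" using Q1 Q2 s by auto
  with sub have xy: "0 \<le> x1" "0 \<le> x2" "0 \<le> y1" "0 \<le> y2" "y1 + s \<le> 1" "y2 + s \<le> 1"
    by (auto simp: unit_square_def)
  have near: "\<bar>x1 - x2\<bar> \<le> s" "\<bar>y1 - y2\<bar> \<le> s" using ne unfolding Q1 Q2 by auto
  define x0 where "x0 = min x1 x2"
  have x0: "0 \<le> x0" "x1 \<in> {x0..x0 + s}" "x2 \<in> {x0..x0 + s}" using xy near by (auto simp: x0_def)
  have y1: "y1 \<in> {0..1}" using xy s by auto
  obtain c where c: "c > 0"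
    "\<And>x t. x \<in> {x0..x0 + s} \<Longrightarrow> t \<in> {0..1} \<Longrightarrow> \<bar>t - y1\<bar> \<le> 2 * s \<Longrightarrow>
       c * s * (1 - 48 * a) / osc a \<le> distr_fun (a * t) (x + s) - distr_fun (a * t) x \<and>
       distr_fun (a * t) (x + s) - distr_fun (a * t) x \<le> osc a * c * s * (1 + 48 * a)"
    using distr_fun_window[OF a s x0(1) y1] by metis
  let ?l = "c * s * (1 - 48 * a) / osc a" and ?u = "osc a * c * s * (1 + 48 * a)"
  have osc: "1 \<le> osc a" using osc_ge_1 a by simp
  have l: "0 < ?l" using c s a osc by simp
  have a': "a \<le> 1/2" and l': "0 \<le> ?l" using a l by auto
  have "t \<in> {0..1} \<and> \<bar>t - y1\<bar> \<le> 2 * s" if "t \<in> {y1..y1 + s} \<or> t \<in> {y2..y2 + s}" for t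
    using that xy near s by auto
  note t = this[THEN conjunct1] this[THEN conjunct2]
  note B1 = emeasure_rect_bounds[OF a(1) a' Q1 sub(1) s c(2)[OF x0(2) t, OF disjI1 disjI1] l']
  note B2 = emeasure_rect_bounds[OF a(1) a' Q2 sub(2) s c(2)[OF x0(3) t, OF disjI2 disjI2] l']
  have "0 < ennreal (?l * s)" using mult_pos_pos[OF l s] by simp
  then have pos: "0 < emeasure (plane_measure a) Q1" using B1(1) by (rule less_le_trans)
  have "?u * s = doubling_bound a * (?l * s)"
    using osc a by (simp add: doubling_bound_def power2_eq_square field_simps)
  moreover have db: "0 \<le> doubling_bound a" using osc a by (simp add: doubling_bound_def)
  ultimately have "ennreal (?u * s) = ennreal (doubling_bound a) * ennreal (?l * s)"
    by (simp only: ennreal_mult[OF db less_imp_le[OF mult_pos_pos[OF l s]]])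
  also have "\<dots> \<le> ennreal (doubling_bound a) * emeasure (plane_measure a) Q2"
    by (rule mult_left_mono[OF B2(1)]) auto
  finally have "emeasure (plane_measure a) Q1 \<le> ennreal (doubling_bound a) * emeasure (plane_measure a) Q2"
    using B1(2) by (rule order_trans[rotated])
  moreover have "ennreal (doubling_bound a) * emeasure (plane_measure a) Q2 < \<infinity>"
    using B2(2) by (auto simp: ennreal_mult_less_top intro: le_less_trans)
  ultimately show "0 < emeasure (square_measure a) Q1 \<and>
      emeasure (square_measure a) Q1 \<le> ennreal (doubling_bound a) * emeasure (square_measure a) Q2 \<and>
      ennreal (doubling_bound a) * emeasure (square_measure a) Q2 < \<infinity>"
    using pos sub by (simp add: emeasure_square_measure)
qed

section \<open>Concentration on a graph\<close>

(* Given t, the n signs are independent with mean a * t. *)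
definition atypical :: "real \<Rightarrow> nat \<Rightarrow> real \<Rightarrow> (real \<times> real) set" where
  "atypical a n d = {(x, t) \<in> unit_square. d \<le> \<bar>sign_sum n (cell n x) - n * (a * t)\<bar>}"

lemma borel_measurable_sign_sum_cell [measurable]: "(\<lambda>x. sign_sum n (cell n x)) \<in> borel_measurable borel"
proof -
  have "cell n \<in> borel \<rightarrow>\<^sub>M count_space UNIV"
    unfolding cell_def by measurable
  from measurable_compose[OF this, of "sign_sum n" borel] show ?thesis by simp
qed

lemma borel_atypical [measurable, simp]: "atypical a n d \<in> sets borel"
proof -
  let ?g = "\<lambda>p :: real \<times> real. \<bar>sign_sum n (cell n (fst p)) - n * (a * snd p)\<bar>"
  have "?g \<in> borel_measurable borel"
    unfolding borel_prod[symmetric] by measurable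
  then have "?g -` {d..} \<in> sets borel"
    using measurable_sets[of ?g borel borel "{d..}"] by simp
  moreover have "atypical a n d = unit_square \<inter> ?g -` {d..}"
    by (auto simp: atypical_def)
  ultimately show ?thesis by simp
qed

text \<open>With \<open>8 ^ k\<close> digits and tolerance \<open>4 ^ k\<close>, Chebyshev's bound
  is \<open>8 ^ k / 16 ^ k = (1/2) ^ k\<close>, which is summable, while the relative tolerance
  \<open>4 ^ k / 8 ^ k\<close> still tends to 0.\<close>

definition typical :: "real \<Rightarrow> (real \<times> real) set" where
  "typical a = {p \<in> unit_square. \<forall>\<^sub>F k in sequentially. p \<notin> atypical a (8 ^ k) (4 ^ k)}"

lemma borel_typical: "typical a \<in> sets borel"
  unfolding typical_def eventually_sequentially by measurable

context
  fixes a :: real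
  assumes a: "0 < a" "a \<le> 1/2"
begin

lemma emeasure_atypical_le:
  assumes d: "0 < d"
  shows "emeasure (plane_measure a) (atypical a n d) \<le> ennreal (n / d\<^sup>2)"
proof (rule emeasure_plane_measure_le[OF a])
  fix t :: real assume t: "t \<in> {0..1}"
  note b = param_bounds[OF a t, THEN conjunct1] param_bounds[OF a t, THEN conjunct2]
  let ?F = "distr_fun (a * t)"
  define B where "B = {i. i < 4 ^ n \<and> d \<le> \<bar>sign_sum n i - n * (a * t)\<bar>}"
  have "finite B" by (simp add: B_def)
  \<comment> \<open>The point \<open>x = 1\<close> has cell index \<open>4 ^ n\<close>, just outside
    the range of \<open>B\<close>, so its image 1 is covered separately as a null set.\<close>
  have "?F ` {x \<in> {0..1}. (x, t) \<in> atypical a n d} \<subseteq> {1} \<union> (\<Union>i\<in>B. {?F (real i / 4 ^ n)..?F (real (Suc i) / 4 ^ n)})"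
  proof (clarsimp simp del: of_nat_Suc)
    fix x assume x: "0 \<le> x" "x \<le> 1" "(x, t) \<in> atypical a n d"
      and no: "\<forall>i\<in>B. ?F (real i / 4 ^ n) \<le> ?F x \<longrightarrow> \<not> ?F x \<le> ?F (real (Suc i) / 4 ^ n)"
    note c = cell_bounds[OF x(1), of n]
    show "?F x = 1"
    proof (cases "x = 1")
      case True
      then show ?thesis using distr_fun_1[OF b] by simp
    next
      case False
      then have "4 ^ n * x < 4 ^ n * 1" using x(2) by (intro mult_strict_left_mono) auto
      then have "real (cell n x) < 4 ^ n" using c by linarith
      then have "cell n x < 4 ^ n"
        by (simp only: of_nat_less_iff[symmetric, where 'a = real] of_nat_power of_nat_numeral)
      then have "cell n x \<in> B" using x(3) unfolding B_def atypical_def by simp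
      moreover have "?F (real (cell n x) / 4 ^ n) \<le> ?F x" "?F x \<le> ?F (real (Suc (cell n x)) / 4 ^ n)"
        using c x(1) by (auto intro!: distr_fun_mono[OF b] simp: field_simps)
      ultimately show ?thesis using no by blast
    qed
  qed
  then have "emeasure lborel (?F ` {x \<in> {0..1}. (x, t) \<in> atypical a n d})
      \<le> emeasure lborel ({1} \<union> (\<Union>i\<in>B. {?F (real i / 4 ^ n)..?F (real (Suc i) / 4 ^ n)}))"
    using \<open>finite B\<close> by (intro emeasure_mono) auto
  also have "\<dots> \<le> emeasure lborel {1::real} + emeasure lborel (\<Union>i\<in>B. {?F (real i / 4 ^ n)..?F (real (Suc i) / 4 ^ n)})"
    using \<open>finite B\<close> by (intro emeasure_subadditive) auto
  also have "\<dots> \<le> 0 + (\<Sum>i\<in>B. emeasure lborel {?F (real i / 4 ^ n)..?F (real (Suc i) / 4 ^ n)})"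
    using \<open>finite B\<close> by (intro add_mono emeasure_subadditive_finite) auto
  also have "\<dots> = (\<Sum>i\<in>B. ennreal (wt (a * t) n i / 4 ^ n))"
  proof -
    have "emeasure lborel {?F (real i / 4 ^ n)..?F (real (Suc i) / 4 ^ n)} = ennreal (wt (a * t) n i / 4 ^ n)" for i
      unfolding distr_fun_grid[OF b] using wt_pos[OF b, of n i] by (simp add: field_simps)
    then show ?thesis by simp
  qed
  also have "\<dots> = ennreal ((\<Sum>i\<in>B. wt (a * t) n i) / 4 ^ n)"
    using wt_pos[OF b, THEN less_imp_le] by (simp add: sum_divide_distrib)
  also have "\<dots> \<le> ennreal (n / d\<^sup>2)"
    unfolding B_def by (intro ennreal_leI sign_sum_chebyshev b d)
  finally show "emeasure lborel (?F ` {x \<in> {0..1}. (x, t) \<in> atypical a n d}) \<le> ennreal (n / d\<^sup>2)" .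
qed simp

lemma emeasure_plane_measure_unit_square: "emeasure (plane_measure a) unit_square = 1"
proof -
  have "1 \<le> distr_fun (a * t) (0 + 1) - distr_fun (a * t) 0 \<and> distr_fun (a * t) (0 + 1) - distr_fun (a * t) 0 \<le> 1"
    if "t \<in> {0..0 + 1}" for t
    using param_bounds[OF a, of t] that by simp
  from emeasure_rect_bounds[OF a, of unit_square 0 1 0 1 1, OF _ _ _ this]
  show ?thesis by (intro antisym) (auto simp: unit_square_def)
qed

lemma finite_measure_plane_measure: "finite_measure (plane_measure a)"
proof (rule finite_measureI)
  have "emeasure (plane_measure a) UNIV \<le> 1"
  proof (rule emeasure_plane_measure_le[OF a])
    fix t :: real assume t: "t \<in> {0..1}"
    have "{x \<in> {0..1}. (x, t) \<in> UNIV} = {0..1::real}" by auto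
    then show "emeasure lborel (distr_fun (a * t) ` {x \<in> {0..1}. (x, t) \<in> UNIV}) \<le> 1"
      using distr_fun_image_Icc[of "a * t" 0 1] param_bounds[OF a t] by simp
  qed simp
  then show "emeasure (plane_measure a) (space (plane_measure a)) \<noteq> \<infinity>"
    by (auto simp: top_unique)
qed

text \<open>By the Borel-Cantelli lemma almost every point lies in only finitely many of the
  atypical sets.\<close>

lemma emeasure_typical: "emeasure (plane_measure a) (typical a) = 1"
proof -
  interpret finite_measure "plane_measure a" by (rule finite_measure_plane_measure)
  have le: "measure (plane_measure a) (atypical a (8 ^ k) (4 ^ k)) \<le> (1/2) ^ k" for k
  proof -
    have "real (8 ^ k) / (4 ^ k)\<^sup>2 = (1/2) ^ k"
      by (simp add: power_mult_distrib[symmetric] power2_eq_square power_divide[symmetric])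
    then have "emeasure (plane_measure a) (atypical a (8 ^ k) (4 ^ k)) \<le> ennreal ((1/2) ^ k)"
      using emeasure_atypical_le[of "4 ^ k" "8 ^ k"] by simp
    then show ?thesis by (simp add: emeasure_eq_measure)
  qed
  have "AE p in plane_measure a. \<forall>\<^sub>F k in sequentially. p \<in> space (plane_measure a) - atypical a (8 ^ k) (4 ^ k)"
  proof (rule borel_cantelli_AE1)
    show "summable (\<lambda>k. measure (plane_measure a) (atypical a (8 ^ k) (4 ^ k)))"
      by (rule summable_comparison_test'[of "\<lambda>k. (1/2::real) ^ k" 0]) (use le in auto)
  qed (simp_all add: emeasure_eq_measure)
  then have "AE p in plane_measure a. p \<in> typical a \<longleftrightarrow> p \<in> unit_square"
    by eventually_elim (auto simp: typical_def)
  then have "emeasure (plane_measure a) (typical a) = emeasure (plane_measure a) unit_square"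
    using borel_typical by (intro emeasure_eq_AE) auto
  then show ?thesis by (simp add: emeasure_plane_measure_unit_square)
qed

text \<open>The digit average depends on the first coordinate alone and approximates
  \<open>a\<close> times the height within \<open>(1/2) ^ k\<close> for both points, so their
  heights agree in the limit.\<close>

lemma inj_on_fst_typical: "inj_on fst (typical a)"
proof (rule inj_onI)
  fix p q assume p: "p \<in> typical a" and q: "q \<in> typical a" and eq: "fst p = fst q"
  have "p \<in> unit_square" "q \<in> unit_square" using p q by (auto simp: typical_def)
  have "\<forall>\<^sub>F k in sequentially. p \<notin> atypical a (8 ^ k) (4 ^ k)"
    and "\<forall>\<^sub>F k in sequentially. q \<notin> atypical a (8 ^ k) (4 ^ k)"
    using p q by (simp_all add: typical_def)
  then have "\<forall>\<^sub>F k in sequentially. a * \<bar>snd p - snd q\<bar> \<le> 2 * (1/2) ^ k"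
  proof eventually_elim
    case (elim k)
    define S where "S = sign_sum (8 ^ k) (cell (8 ^ k) (fst p))"
    have "\<bar>S - 8 ^ k * (a * snd p)\<bar> < 4 ^ k" "\<bar>S - 8 ^ k * (a * snd q)\<bar> < 4 ^ k"
      using elim \<open>p \<in> unit_square\<close> \<open>q \<in> unit_square\<close> eq unfolding S_def atypical_def split_beta by auto
    then have "\<bar>8 ^ k * (a * (snd p - snd q))\<bar> \<le> 2 * 4 ^ k" by (simp add: algebra_simps)
    then have "a * \<bar>snd p - snd q\<bar> * 8 ^ k \<le> 2 * 4 ^ k" using a by (simp add: abs_mult ac_simps)
    then have "a * \<bar>snd p - snd q\<bar> \<le> 2 * (4 ^ k / 8 ^ k)" by (simp add: field_simps)
    then show ?case by (simp add: power_divide[symmetric])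
  qed
  moreover have "(\<lambda>k. 2 * (1/2::real) ^ k) \<longlonglongrightarrow> 2 * 0"
    by (intro tendsto_intros LIMSEQ_power_zero) simp
  ultimately have "a * \<bar>snd p - snd q\<bar> \<le> 2 * 0"
    by (intro tendsto_lowerbound[where F=sequentially]) auto
  then show "p = q" using a eq by (simp add: mult_le_0_iff prod_eq_iff)
qed

end

section \<open>From large compact sets to graphs of continuous functions\<close>

lemma compact_subset_graph:
  assumes K: "compact K" "K \<subseteq> unit_square" and inj: "inj_on fst K"
  obtains f :: "real \<Rightarrow> real" where "continuous_on {0..1} f" "f ` {0..1} \<subseteq> {0..1}" "K \<subseteq> graph_on_unit f"
proof -
  \<comment> \<open>On the compact set \<open>K\<close> the injective projection \<open>fst\<close>
    has a continuous inverse, so the height is a continuous function of the first coordinate on a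
    closed set. Tietze's theorem extends it with values in \<open>[0, 1]\<close>.\<close>
  define h where "h = snd \<circ> the_inv_into K fst"
  have "continuous_on (fst ` K) h"
    unfolding h_def
    by (intro continuous_on_compose continuous_on_inv_into K inj continuous_intros)
  moreover have "closedin (top_of_set UNIV) (fst ` K)"
    using K by (simp add: compact_imp_closed compact_continuous_image continuous_on_fst)
  moreover have h: "h (fst p) = snd p" if "p \<in> K" for p
    using the_inv_into_f_f[OF inj that] by (simp add: h_def)
  then have "h x \<in> cbox 0 1" if "x \<in> fst ` K" for x
    using that K(2) by (auto simp: unit_square_def)
  ultimately obtain f :: "real \<Rightarrow> real" where f: "continuous_on UNIV f" "\<And>x. x \<in> fst ` K \<Longrightarrow> f x = h x" "\<And>x. f x \<in> cbox 0 1"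
    using Tietze_closed_interval_1[of "fst ` K" h UNIV 0 1] by auto
  show ?thesis
  proof (rule that)
    show "continuous_on {0..1} f" using f(1) by (rule continuous_on_subset) simp
    show "f ` {0..1} \<subseteq> {0..1}" using f(3) by auto
    show "K \<subseteq> graph_on_unit f"
    proof
      fix p assume p: "p \<in> K"
      then have "f (fst p) = snd p" using f(2) h by simp
      moreover have "fst p \<in> {0..1}" using p K(2) by (auto simp: unit_square_def)
      ultimately show "p \<in> graph_on_unit f"
        unfolding graph_on_unit_def by (auto intro!: exI[of _ "fst p"] simp: prod_eq_iff)
    qed
  qed
qed

lemma compact_graph_on_unit: "continuous_on {0..1} f \<Longrightarrow> compact (graph_on_unit f)"
proof -
  assume "continuous_on {0..1} f"
  then have "compact ((\<lambda>x. (x, f x)) ` {0..1})"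
    by (intro compact_continuous_image continuous_intros) auto
  then show ?thesis by (simp only: graph_on_unit_def setcompr_eq_image Collect_mem_eq)
qed

lemma doubling_bound_tendsto: "(doubling_bound \<longlongrightarrow> 1) (at_right 0)"
proof -
  have "(doubling_bound \<longlongrightarrow> ((1 + 0) / (1 - 0) * exp (2 * 0))\<^sup>2 * ((1 + 48 * 0) / (1 - 48 * 0))) (at_right 0)"
    unfolding doubling_bound_def osc_def by (intro tendsto_intros) auto
  then show ?thesis by simp
qed

(* A doubling measure is finite, so the real-valued measure loses nothing; unlike
   the ennreal-valued one it keeps the factor 1 - eps negative when eps > 1. *)
theorem theorem1p1:
  fixes \<epsilon> :: real
  assumes "\<epsilon> > 0"
  shows "\<exists>(M :: (real \<times> real) measure) (f :: real \<Rightarrow> real).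
           doubling_measure M \<and>
           (\<exists>C. doubling_constant M C \<and> C < 1 + \<epsilon>) \<and>
           continuous_on {0..1} f \<and> f ` {0..1} \<subseteq> {0..1} \<and>
           measure M (graph_on_unit f) > (1 - \<epsilon>) * measure M unit_square"
proof -
  have "\<forall>\<^sub>F a in at_right 0. doubling_bound a < 1 + \<epsilon>"
    using assms by (intro order_tendstoD(2)[OF doubling_bound_tendsto]) simp
  moreover have "\<forall>\<^sub>F a in at_right (0::real). a \<in> {0<..<1/48}"
    by (rule eventually_at_right_real) simp
  ultimately have "\<forall>\<^sub>F a in at_right 0. doubling_bound a < 1 + \<epsilon> \<and> a \<in> {0<..<1/48}"
    by (rule eventually_conj)
  then obtain a where C: "doubling_bound a < 1 + \<epsilon>" and a: "0 < a" "a < 1/48"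
    using eventually_happens'[of "at_right (0::real)"] by fastforce
  have a': "a \<le> 1/2" using a by simp
  interpret finite_measure "plane_measure a" by (rule finite_measure_plane_measure[OF a(1) a'])
  \<comment> \<open>For \<epsilon> > 1 the left side is truncated to 0, which is still below 1, so
    the same argument covers all \<epsilon>. Inner regularity then provides a compact subset of
    \<open>typical a\<close> of nearly full measure.\<close>
  have "ennreal (1 - \<epsilon>) < ennreal 1" using assms by (intro ennreal_lessI) auto
  also have "\<dots> = (SUP K\<in>{K. K \<subseteq> typical a \<and> compact K}. emeasure (plane_measure a) K)"
    using inner_regular[OF sets_plane_measure _ borel_typical, of a a] emeasure_finite
      emeasure_typical[OF a(1) a'] by simp
  finally have "ennreal (1 - \<epsilon>) < (SUP K\<in>{K. K \<subseteq> typical a \<and> compact K}. emeasure (plane_measure a) K)" .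
  then obtain K where K: "K \<subseteq> typical a" "compact K" "ennreal (1 - \<epsilon>) < emeasure (plane_measure a) K"
    unfolding less_SUP_iff by auto
  have inj: "inj_on fst K" using inj_on_fst_typical[OF a(1) a'] K(1) by (rule inj_on_subset)
  have "K \<subseteq> unit_square" using K(1) by (auto simp: typical_def)
  then obtain f where f: "continuous_on {0..1} f" "f ` {0..1} \<subseteq> {0..1}" "K \<subseteq> graph_on_unit f"
    using compact_subset_graph[OF K(2) _ inj] by blast
  have sub: "graph_on_unit f \<subseteq> unit_square" using f(2) by (auto simp: graph_on_unit_def unit_square_def)
  have "1 - \<epsilon> < measure (plane_measure a) K"
    using K(3) ennreal_leI[of "measure (plane_measure a) K" "1 - \<epsilon>"] by (force simp: emeasure_eq_measure)
  also have "\<dots> \<le> measure (plane_measure a) (graph_on_unit f)"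
    using f(3) compact_graph_on_unit[OF f(1)] by (intro finite_measure_mono) (simp_all add: borel_compact)
  also have "\<dots> = measure (square_measure a) (graph_on_unit f)"
    by (simp add: measure_def emeasure_square_measure sub)
  finally have "1 - \<epsilon> < measure (square_measure a) (graph_on_unit f)" .
  moreover have "measure (square_measure a) unit_square = 1"
    using emeasure_plane_measure_unit_square[OF a(1) a'] by (simp add: measure_def emeasure_square_measure)
  moreover have "doubling_constant (square_measure a) (doubling_bound a)"
    by (rule doubling_constant_square_measure[OF a])
  ultimately show ?thesis
    using borel_regular_on_square_measure C f(1,2)
    by (intro exI[of _ "square_measure a"] exI[of _ f]) (auto simp: doubling_measure_def)
qed

end
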